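(* Let $\mu$ be a risk measure on $L^\infty(\mathbb{P})$. Then, for every $X \in L^\infty(\mathbb{P})$, $$\mu(X) = \min_{\substack{Y \in L^\infty(\mathbb{P}) \\ \mu(Y) = 0}} \; \max_{p \in \Delta(\mathbb{P})} \; \mathbb{E}_p[Y - X] .$$
   Context: $(\Omega, \mathcal{F}, \mathbb{P})$ is a probability space. $L^\infty(\mathbb{P})$ is the space of equivalence classes of almost surely bounded real-valued random variables, with the usual $L^\infty$ norm and the usual partial order ($X \leq Y$ if $Y - X \geq 0$ almost surely); $e$ denotes the random variable almost surely equal to $1$. The topological dual of $L^\infty(\mathbb{P})$ is the space $\mathsf{ba}(\mathbb{P})$ of finitely additive (signed) measures of bounded variation that are absolutely continuous with respect to $\mathbb{P}$; for $p \in \mathsf{ba}(\mathbb{P})$ and $X \in L^\infty(\mathbb{P})$, $\mathbb{E}_p[X]$ denotes the duality product $\langle p, X\rangle$. $\mathsf{ba}^+(\mathbb{P})$ is the set of positive elements of $\mathsf{ba}(\mathbb{P})$ and $\Delta(\mathbb{P}) := \{ p \in \mathsf{ba}^+(\mathbb{P}) \mid \mathbb{E}_p[e] = 1 \}$ is the set of finitely additive probability measures. A risk measure is a function $\mu : L^\infty(\mathbb{P}) \to \mathbb{R}$ such that, for all $X, Y \in L^\infty(\mathbb{P})$: $X \leq Y$ implies $\mu(X) \geq \mu(Y)$; and $\mu(X + \lambda e) = \mu(X) - \lambda$ for all $\lambda \in \mathbb{R}$. Writing $\min$ and $\max$ means that the extrema are attained. *)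

theory Defs
  imports "HOL-Probability.Probability"
begin

text \<open>
  Elements of the space \<open>L\<^sup>\<infinity>\<close> are handled, as usual in the measure theory library, through
  representatives. The order is the almost sure one, so that a risk measure (defined below)
  depends only on the almost sure equivalence class of its argument.
\<close>

definition Linf :: "'a measure \<Rightarrow> ('a \<Rightarrow> real) set" where
  "Linf M = {X \<in> borel_measurable M. \<exists>C. AE x in M. \<bar>X x\<bar> \<le> C}"

text \<open>Convergence in the \<open>L\<^sup>\<infinity>\<close> norm, i.e. uniform convergence outside null sets.\<close>

definition Linf_tendsto :: "'a measure \<Rightarrow> (nat \<Rightarrow> 'a \<Rightarrow> real) \<Rightarrow> ('a \<Rightarrow> real) \<Rightarrow> bool" where
  "Linf_tendsto M s X \<longleftrightarrow>
    (\<forall>\<epsilon>>0. \<forall>\<^sub>F n in sequentially. AE x in M. \<bar>s n x - X x\<bar> \<le> \<epsilon>)"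

text \<open>
  Set functions are considered on the measurable sets only; the values taken elsewhere by
  the representing HOL function are irrelevant.
\<close>

definition ba :: "'a measure \<Rightarrow> ('a set \<Rightarrow> real) set" where
  "ba M = {p.
     (\<forall>A\<in>sets M. \<forall>B\<in>sets M. A \<inter> B = {} \<longrightarrow> p (A \<union> B) = p A + p B) \<and>
     (\<exists>C. \<forall>\<A>. finite \<A> \<and> disjoint \<A> \<and> \<A> \<subseteq> sets M \<longrightarrow> (\<Sum>A\<in>\<A>. \<bar>p A\<bar>) \<le> C) \<and>
     (\<forall>A\<in>sets M. emeasure M A = 0 \<longrightarrow> p A = 0)}"

definition ba_pos :: "'a measure \<Rightarrow> ('a set \<Rightarrow> real) set" where
  "ba_pos M = {p \<in> ba M. \<forall>A\<in>sets M. 0 \<le> p A}"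

definition fa_simple_integral :: "'a measure \<Rightarrow> ('a set \<Rightarrow> real) \<Rightarrow> ('a \<Rightarrow> real) \<Rightarrow> real" where
  "fa_simple_integral M p f = (\<Sum>y\<in>f ` space M. y * p (f -` {y} \<inter> space M))"

text \<open>
  The duality product \<open>\<langle>p, X\<rangle>\<close> is the Dunford--Schwartz integral with respect to a finitely
  additive measure: the common limit of the elementary integrals along all sequences of simple
  functions that converge to \<open>X\<close> in the \<open>L\<^sup>\<infinity>\<close> norm. This limit exists and is unique for
  \<open>p \<in> ba M\<close> and \<open>X \<in> Linf M\<close>, see \<open>fa_expectation_tendsto\<close> below.
\<close>

definition fa_expectation :: "'a measure \<Rightarrow> ('a set \<Rightarrow> real) \<Rightarrow> ('a \<Rightarrow> real) \<Rightarrow> real" where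
  "fa_expectation M p X =
    (THE l. \<forall>s. (\<forall>n. simple_function M (s n)) \<and> Linf_tendsto M s X
        \<longrightarrow> (\<lambda>n. fa_simple_integral M p (s n)) \<longlonglongrightarrow> l)"

definition fa_probs :: "'a measure \<Rightarrow> ('a set \<Rightarrow> real) set" where
  "fa_probs M = {p \<in> ba_pos M. fa_expectation M p (\<lambda>_. 1) = 1}"

definition risk_measure :: "'a measure \<Rightarrow> (('a \<Rightarrow> real) \<Rightarrow> real) \<Rightarrow> bool" where
  "risk_measure M \<mu> \<longleftrightarrow>
    (\<forall>X\<in>Linf M. \<forall>Y\<in>Linf M. (AE x in M. X x \<le> Y x) \<longrightarrow> \<mu> X \<ge> \<mu> Y) \<and>
    (\<forall>X\<in>Linf M. \<forall>c::real. \<mu> (\<lambda>x. X x + c) = \<mu> X - c)"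

definition is_minimum :: "real set \<Rightarrow> real \<Rightarrow> bool" where
  "is_minimum S m \<longleftrightarrow> m \<in> S \<and> (\<forall>s\<in>S. m \<le> s)"

definition is_maximum :: "real set \<Rightarrow> real \<Rightarrow> bool" where
  "is_maximum S m \<longleftrightarrow> m \<in> S \<and> (\<forall>s\<in>S. s \<le> m)"

lemma risk_measure_cong_AE:
  assumes "risk_measure M \<mu>" "X \<in> Linf M" "Y \<in> Linf M" "AE x in M. X x = Y x"
  shows "\<mu> X = \<mu> Y"
proof -
  have "AE x in M. X x \<le> Y x" "AE x in M. Y x \<le> X x"
    using assms(4) by auto
  with assms show ?thesis
    unfolding risk_measure_def by (meson order_antisym)
qed

lemma ba_empty: "p \<in> ba M \<Longrightarrow> p {} = 0"
  by (auto simp: ba_def)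

lemma ba_UN:
  assumes p: "p \<in> ba M" and "finite I" and "\<And>i. i \<in> I \<Longrightarrow> A i \<in> sets M"
    and "disjoint_family_on A I"
  shows "p (\<Union>i\<in>I. A i) = (\<Sum>i\<in>I. p (A i))"
  using assms(2-)
proof (induction I)
  case empty
  then show ?case using ba_empty[OF p] by simp
next
  case (insert i I)
  have add: "\<And>A B. A \<in> sets M \<Longrightarrow> B \<in> sets M \<Longrightarrow> A \<inter> B = {} \<Longrightarrow> p (A \<union> B) = p A + p B"
    using p by (auto simp: ba_def)
  have "A i \<inter> (\<Union>j\<in>I. A j) = {}"
    using insert.hyps insert.prems(2) by (fastforce simp: disjoint_family_on_def)
  then have "p (A i \<union> (\<Union>j\<in>I. A j)) = p (A i) + p (\<Union>j\<in>I. A j)"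
    using insert by (intro add) auto
  moreover have "disjoint_family_on A I"
    using insert.prems(2) by (auto simp: disjoint_family_on_def)
  ultimately show ?case using insert by simp
qed

lemma fa_simple_integral_partition:
  assumes p: "p \<in> ba M" and f: "simple_function M f" and g: "simple_function M g"
    and v: "\<And>x. x \<in> space M \<Longrightarrow> f x = v (g x)"
  shows "fa_simple_integral M p f = (\<Sum>z\<in>g ` space M. v z * p (g -` {z} \<inter> space M))"
proof -
  have fin: "finite (g ` space M)" "finite (f ` space M)"
    using f g by (auto dest: simple_functionD)
  have "p (f -` {y} \<inter> space M) = (\<Sum>z | z \<in> g ` space M \<and> v z = y. p (g -` {z} \<inter> space M))"
    for y
  proof -
    have "f -` {y} \<inter> space M = (\<Union>z\<in>{z \<in> g ` space M. v z = y}. g -` {z} \<inter> space M)"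
      using v by auto
    then show ?thesis
      using fin by (simp only:) (rule ba_UN[OF p],
        auto simp: disjoint_family_on_def intro: simple_functionD(2)[OF g])
  qed
  then have "fa_simple_integral M p f =
      (\<Sum>y\<in>f ` space M. \<Sum>z | z \<in> g ` space M \<and> v z = y. v z * p (g -` {z} \<inter> space M))"
    by (auto simp: fa_simple_integral_def sum_distrib_left intro!: sum.cong)
  also have "\<dots> = (\<Sum>z\<in>g ` space M. v z * p (g -` {z} \<inter> space M))"
    by (rule sum.group) (use fin v in auto)
  finally show ?thesis .
qed

lemma fa_simple_integral_diff_le:
  assumes p: "p \<in> ba M"
    and C: "\<And>\<A>. finite \<A> \<Longrightarrow> disjoint \<A> \<Longrightarrow> \<A> \<subseteq> sets M \<Longrightarrow> (\<Sum>A\<in>\<A>. \<bar>p A\<bar>) \<le> C"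
    and f: "simple_function M f" and g: "simple_function M g"
    and e: "AE x in M. \<bar>f x - g x\<bar> \<le> e" "0 \<le> e"
  shows "\<bar>fa_simple_integral M p f - fa_simple_integral M p g\<bar> \<le> e * C"
proof -
  define h where "h = (\<lambda>x. (f x, g x))"
  define Z where "Z = h ` space M"
  define D where "D = (\<lambda>z. h -` {z} \<inter> space M)"
  have h: "simple_function M h"
    unfolding h_def using f g by (rule simple_function_Pair)
  have fin: "finite Z" using h by (auto simp: Z_def dest: simple_functionD)
  have D: "D z \<in> sets M" for z
    unfolding D_def by (rule simple_functionD(2)[OF h])
  have "fa_simple_integral M p f = (\<Sum>z\<in>Z. fst z * p (D z))"
    unfolding Z_def D_def by (rule fa_simple_integral_partition[OF p f h]) (simp add: h_def)
  moreover have "fa_simple_integral M p g = (\<Sum>z\<in>Z. snd z * p (D z))"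
    unfolding Z_def D_def by (rule fa_simple_integral_partition[OF p g h]) (simp add: h_def)
  ultimately have "fa_simple_integral M p f - fa_simple_integral M p g
      = (\<Sum>z\<in>Z. (fst z - snd z) * p (D z))"
    by (simp add: sum_subtractf left_diff_distrib)
  also have "\<bar>\<dots>\<bar> \<le> (\<Sum>z\<in>Z. \<bar>(fst z - snd z) * p (D z)\<bar>)"
    by (rule sum_abs)
  also have "\<dots> \<le> (\<Sum>z\<in>Z. e * \<bar>p (D z)\<bar>)"
  proof (rule sum_mono)
    fix z
    show "\<bar>(fst z - snd z) * p (D z)\<bar> \<le> e * \<bar>p (D z)\<bar>"
    proof (cases "\<bar>fst z - snd z\<bar> \<le> e")
      case True
      then show ?thesis by (simp add: abs_mult mult_right_mono)
    next
      case False
      have "AE x in M. x \<notin> D z"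
        using e(1) by eventually_elim (use False in \<open>auto simp: D_def h_def\<close>)
      then have "emeasure M (D z) = 0"
        using D AE_iff_null_sets[of "D z" M] by auto
      then have "p (D z) = 0" using p D by (auto simp: ba_def)
      then show ?thesis by simp
    qed
  qed
  also have "\<dots> = e * (\<Sum>z\<in>Z. \<bar>p (D z)\<bar>)"
    by (simp add: sum_distrib_left)
  also have "(\<Sum>z\<in>Z. \<bar>p (D z)\<bar>) = (\<Sum>A\<in>D ` Z. \<bar>p A\<bar>)"
  proof -
    have "inj_on D Z"
    proof (rule inj_onI)
      fix z w assume "z \<in> Z" "w \<in> Z" "D z = D w"
      from \<open>z \<in> Z\<close> obtain x where "x \<in> space M" "h x = z" by (auto simp: Z_def)
      then have "x \<in> D z" by (simp add: D_def)
      with \<open>D z = D w\<close> \<open>h x = z\<close> show "z = w" by (simp add: D_def)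
    qed
    then show ?thesis by (simp add: sum.reindex)
  qed
  also have "e * \<dots> \<le> e * C"
    by (intro mult_left_mono C e(2)) (use fin D in \<open>auto simp: disjoint_def D_def\<close>)
  finally show ?thesis .
qed

lemma Linf_simple_approx:
  assumes "X \<in> Linf M"
  obtains s where "\<And>n. simple_function M (s n)" "Linf_tendsto M s X"
proof -
  obtain C where X: "X \<in> borel_measurable M" and C: "AE x in M. \<bar>X x\<bar> \<le> C"
    using assms by (auto simp: Linf_def)
  define t where "t = (\<lambda>x. max (-C) (min C (X x)))"
  define s where "s = (\<lambda>n x. real_of_int \<lfloor>real (Suc n) * t x\<rfloor> / real (Suc n))"
  have t: "t \<in> borel_measurable M" unfolding t_def using X by measurable
  have "simple_function M (s n)" for n
  proof (rule simple_function_borel_measurable)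
    show "s n \<in> borel_measurable M" unfolding s_def using t by measurable
    have "\<lfloor>real (Suc n) * t x\<rfloor> \<in> {\<lfloor>real (Suc n) * (-\<bar>C\<bar>)\<rfloor>..\<lfloor>real (Suc n) * \<bar>C\<bar>\<rfloor>}" for x
    proof -
      have "-\<bar>C\<bar> \<le> t x" "t x \<le> \<bar>C\<bar>" by (auto simp: t_def)
      then show ?thesis
        unfolding atLeastAtMost_iff by (intro conjI floor_mono mult_left_mono) auto
    qed
    then have "s n ` space M \<subseteq> (\<lambda>k. real_of_int k / real (Suc n)) `
        {\<lfloor>real (Suc n) * (-\<bar>C\<bar>)\<rfloor>..\<lfloor>real (Suc n) * \<bar>C\<bar>\<rfloor>}"
      unfolding s_def by blast
    then show "finite (s n ` space M)" by (rule finite_subset) simp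
  qed
  moreover have "Linf_tendsto M s X"
    unfolding Linf_tendsto_def
  proof (intro allI impI)
    fix e :: real assume "0 < e"
    then have "\<forall>\<^sub>F n in sequentially. 1 / real (Suc n) < e"
      by real_asymp
    then show "\<forall>\<^sub>F n in sequentially. AE x in M. \<bar>s n x - X x\<bar> \<le> e"
    proof eventually_elim
      case (elim n)
      show ?case
        using C
      proof eventually_elim
        case (elim x)
        then have "t x = X x" by (auto simp: t_def)
        moreover have "\<bar>real_of_int \<lfloor>real (Suc n) * t x\<rfloor> - real (Suc n) * t x\<bar> \<le> 1"
          by linarith
        then have "\<bar>real_of_int \<lfloor>real (Suc n) * t x\<rfloor> - real (Suc n) * t x\<bar> / real (Suc n)
            \<le> 1 / real (Suc n)"
          by (rule divide_right_mono) simp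
        moreover have "\<bar>s n x - t x\<bar> =
            \<bar>real_of_int \<lfloor>real (Suc n) * t x\<rfloor> - real (Suc n) * t x\<bar> / real (Suc n)"
        proof -
          have "s n x - t x =
              (real_of_int \<lfloor>real (Suc n) * t x\<rfloor> - real (Suc n) * t x) / real (Suc n)"
            unfolding s_def by (simp add: diff_divide_distrib del: of_nat_Suc)
          then show ?thesis by simp
        qed
        ultimately show ?case using \<open>1 / real (Suc n) < e\<close> by linarith
      qed
    qed
  qed
  ultimately show ?thesis by (rule that)
qed

lemma fa_expectation_tendsto:
  assumes p: "p \<in> ba M" and X: "X \<in> Linf M"
    and s: "\<And>n. simple_function M (s n)" "Linf_tendsto M s X"
  shows "(\<lambda>n. fa_simple_integral M p (s n)) \<longlonglongrightarrow> fa_expectation M p X"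
proof -
  let ?I = "fa_simple_integral M p"
  let ?A = "\<lambda>s. (\<forall>n. simple_function M (s n)) \<and> Linf_tendsto M s X"
  obtain C0 where C0: "\<And>\<A>. finite \<A> \<Longrightarrow> disjoint \<A> \<Longrightarrow> \<A> \<subseteq> sets M \<Longrightarrow> (\<Sum>A\<in>\<A>. \<bar>p A\<bar>) \<le> C0"
    using p unfolding ba_def by blast
  define C where "C = \<bar>C0\<bar> + 1"
  have C: "\<And>\<A>. finite \<A> \<Longrightarrow> disjoint \<A> \<Longrightarrow> \<A> \<subseteq> sets M \<Longrightarrow> (\<Sum>A\<in>\<A>. \<bar>p A\<bar>) \<le> C"
    unfolding C_def by (rule order_trans[OF C0]) auto
  have "C > 0" by (simp add: C_def)
  have close: "\<exists>N. \<forall>m\<ge>N. \<forall>n\<ge>N. \<bar>?I (s m) - ?I (t n)\<bar> < e" if st: "?A s" "?A t" and "e > 0" for s t e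
  proof -
    define d where "d = e / (4 * C)"
    have "d > 0" using \<open>e > 0\<close> \<open>C > 0\<close> by (simp add: d_def)
    then have "\<forall>\<^sub>F n in sequentially. (AE x in M. \<bar>s n x - X x\<bar> \<le> d) \<and> (AE x in M. \<bar>t n x - X x\<bar> \<le> d)"
      using st by (auto simp: Linf_tendsto_def intro: eventually_conj)
    then obtain N where N: "\<And>n. n \<ge> N \<Longrightarrow> (AE x in M. \<bar>s n x - X x\<bar> \<le> d)"
        "\<And>n. n \<ge> N \<Longrightarrow> (AE x in M. \<bar>t n x - X x\<bar> \<le> d)"
      unfolding eventually_sequentially by blast
    have "\<bar>?I (s m) - ?I (t n)\<bar> < e" if "m \<ge> N" "n \<ge> N" for m n
    proof -
      have "AE x in M. \<bar>s m x - t n x\<bar> \<le> 2 * d"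
        using N(1)[OF that(1)] N(2)[OF that(2)] by eventually_elim linarith
      then have "\<bar>?I (s m) - ?I (t n)\<bar> \<le> (2 * d) * C"
        using st \<open>d > 0\<close> by (intro fa_simple_integral_diff_le[OF p C]) auto
      also have "\<dots> < e" using \<open>C > 0\<close> \<open>e > 0\<close> by (simp add: d_def field_simps)
      finally show ?thesis .
    qed
    then show ?thesis by blast
  qed
  have "?A s" using s by blast
  then have "Cauchy (\<lambda>n. ?I (s n))"
    using close[of s s] by (auto simp: Cauchy_def dist_real_def)
  then obtain l where l: "(\<lambda>n. ?I (s n)) \<longlonglongrightarrow> l"
    using Cauchy_convergent_iff convergent_def by blast
  have all: "(\<lambda>n. ?I (t n)) \<longlonglongrightarrow> l" if "?A t" for t
  proof -
    have "(\<lambda>n. ?I (s n) - ?I (t n)) \<longlonglongrightarrow> 0"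
      using close[OF \<open>?A s\<close> that] unfolding LIMSEQ_iff by (auto, blast)
    from tendsto_diff[OF l this] show ?thesis by simp
  qed
  have "fa_expectation M p X = l"
    unfolding fa_expectation_def
  proof (rule the_equality)
    show "\<forall>t. ?A t \<longrightarrow> (\<lambda>n. ?I (t n)) \<longlonglongrightarrow> l" using all by blast
    show "\<And>l'. \<forall>t. ?A t \<longrightarrow> (\<lambda>n. ?I (t n)) \<longlonglongrightarrow> l' \<Longrightarrow> l' = l"
      using \<open>?A s\<close> l LIMSEQ_unique by blast
  qed
  with l show ?thesis by simp
qed

end

theory Submission
  imports Defs
begin

text \<open>
  The inner maximum is an essential supremum: for \<open>Z\<close> in \<open>L\<^sup>\<infinity>\<close>, the maximum of
  \<open>\<langle>p, Z\<rangle>\<close> over the finitely additive probabilities \<open>p\<close> is the least \<open>a\<close> with \<open>Z \<le> a\<close>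
  almost surely. No \<open>p\<close> gives more, because the integral is monotone. The value \<open>a\<close> is attained
  by any \<open>p\<close> that gives measure one to every set \<open>{Z > c}\<close> with \<open>c < a\<close>. These sets have positive
  probability and decrease as \<open>c\<close> increases to \<open>a\<close>, but their intersection may be null, so that
  no countably additive measure will do in general. The conditional
  probabilities given \<open>{Z > c}\<close> lie in the cube \<open>[0,1]\<close> to the power of the power set, which is
  compact in the product topology by Tychonoff's theorem, and the defining conditions of a
  finitely additive probability are closed. The finite intersection property thus yields a single
  \<open>p\<close> for all \<open>c < a\<close> (\<open>fa_probs_concentrated\<close>).

  The formula for the risk measure \<open>\<mu>\<close> follows easily. Let \<open>a\<close> be the essential supremum of
  \<open>Y - X\<close>. Then \<open>Y \<le> X + a\<close>, hence \<open>0 = \<mu> Y \<ge> \<mu> X - a\<close> when \<open>\<mu> Y = 0\<close>. Equality holds for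
  \<open>Y = X + \<mu> X\<close>, for which \<open>Y - X\<close> is constant.
\<close>

section \<open>The pairing with a positive finitely additive measure\<close>

lemma Linf_const: "(\<lambda>_. c) \<in> Linf M"
  unfolding Linf_def by (auto intro!: exI[of _ "\<bar>c\<bar>"])

lemma Linf_diff:
  assumes "X \<in> Linf M" "Y \<in> Linf M"
  shows "(\<lambda>x. X x - Y x) \<in> Linf M"
proof -
  obtain C D where "AE x in M. \<bar>X x\<bar> \<le> C" "AE x in M. \<bar>Y x\<bar> \<le> D"
    using assms by (auto simp: Linf_def)
  then have "AE x in M. \<bar>X x - Y x\<bar> \<le> C + D"
    by eventually_elim linarith
  with assms show ?thesis by (auto simp: Linf_def)
qed

lemma Linf_uminus: "X \<in> Linf M \<Longrightarrow> (\<lambda>x. - X x) \<in> Linf M"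
  by (auto simp: Linf_def)

lemma Linf_add_const: "X \<in> Linf M \<Longrightarrow> (\<lambda>x. X x + c) \<in> Linf M"
  using Linf_diff[OF _ Linf_const[of "- c"]] by simp

lemma fa_simple_integral_uminus:
  assumes p: "p \<in> ba M" and f: "simple_function M f"
  shows "fa_simple_integral M p (\<lambda>x. - f x) = - fa_simple_integral M p f"
proof -
  have "fa_simple_integral M p (\<lambda>x. - f x)
      = (\<Sum>z\<in>f ` space M. - z * p (f -` {z} \<inter> space M))"
    by (rule fa_simple_integral_partition[OF p simple_function_compose1[OF f] f]) simp
  then show ?thesis by (simp add: fa_simple_integral_def sum_negf)
qed

lemma fa_expectation_uminus:
  assumes p: "p \<in> ba M" and X: "X \<in> Linf M"
  shows "fa_expectation M p (\<lambda>x. - X x) = - fa_expectation M p X"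
proof -
  obtain s where s: "\<And>n. simple_function M (s n)" "Linf_tendsto M s X"
    using Linf_simple_approx[OF X] by blast
  have "Linf_tendsto M (\<lambda>n x. - s n x) (\<lambda>x. - X x)"
    using s(2) by (simp add: Linf_tendsto_def abs_minus_commute)
  then have "(\<lambda>n. fa_simple_integral M p (\<lambda>x. - s n x))
      \<longlonglongrightarrow> fa_expectation M p (\<lambda>x. - X x)"
    by (intro fa_expectation_tendsto[OF p Linf_uminus[OF X]] simple_function_compose1[OF s(1)])
  moreover have "(\<lambda>n. fa_simple_integral M p (\<lambda>x. - s n x)) \<longlonglongrightarrow> - fa_expectation M p X"
    unfolding fa_simple_integral_uminus[OF p s(1)]
    by (intro tendsto_minus fa_expectation_tendsto[OF p X s])
  ultimately show ?thesis by (rule LIMSEQ_unique)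
qed

lemma ba_add:
  assumes "p \<in> ba M" "A \<in> sets M" "B \<in> sets M" "A \<inter> B = {}"
  shows "p (A \<union> B) = p A + p B"
  using assms by (auto simp: ba_def)

lemma ba_pos_mono:
  assumes p: "p \<in> ba_pos M" and AB: "A \<in> sets M" "B \<in> sets M" "A \<subseteq> B"
  shows "p A \<le> p B"
proof -
  have "p (A \<union> (B - A)) = p A + p (B - A)"
    using p AB by (intro ba_add) (auto simp: ba_pos_def)
  moreover have "A \<union> (B - A) = B" using AB(3) by blast
  moreover have "0 \<le> p (B - A)" using p AB by (auto simp: ba_pos_def)
  ultimately show ?thesis by simp
qed

lemma ba_pos_eq_0_of_subset_Un:
  assumes p: "p \<in> ba_pos M" and D: "D \<in> sets M" "D \<subseteq> A \<union> B"
    and AB: "A \<in> sets M" "B \<in> sets M" "p A = 0" "p B = 0"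
  shows "p D = 0"
proof -
  have split: "(D \<inter> A) \<union> (D - A) = D" by blast
  have "p ((D \<inter> A) \<union> (D - A)) = p (D \<inter> A) + p (D - A)"
    using p D AB by (intro ba_add) (auto simp: ba_pos_def)
  then have "p D = p (D \<inter> A) + p (D - A)" by (simp only: split)
  moreover have "p (D \<inter> A) \<le> 0"
    using ba_pos_mono[OF p, of "D \<inter> A" A] D AB by auto
  moreover have "p (D - A) \<le> 0"
    using ba_pos_mono[OF p, of "D - A" B] D AB by auto
  moreover have "0 \<le> p D" using p D by (auto simp: ba_pos_def)
  ultimately show ?thesis by linarith
qed

text \<open>
  The exceptional set \<open>N\<close> is negligible for \<open>p\<close> but not necessarily for \<open>M\<close>: a purely finitely
  additive \<open>p\<close> may be concentrated on sets of arbitrarily small probability, and this is how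
  the maximisers below are recognised.
\<close>

lemma fa_expectation_le:
  assumes p: "p \<in> ba_pos M" and X: "X \<in> Linf M"
    and N: "N \<in> sets M" "p N = 0"
    and le: "AE x in M. x \<notin> N \<longrightarrow> X x \<le> c"
  shows "fa_expectation M p X \<le> c * p (space M)"
proof -
  have pb: "p \<in> ba M" using p by (simp add: ba_pos_def)
  obtain s where s: "\<And>n. simple_function M (s n)" "Linf_tendsto M s X"
    using Linf_simple_approx[OF X] by blast
  have lim: "(\<lambda>n. fa_simple_integral M p (s n)) \<longlonglongrightarrow> fa_expectation M p X"
    by (rule fa_expectation_tendsto[OF pb X s])
  have bound: "fa_expectation M p X \<le> (c + e) * p (space M)" if "e > 0" for e
  proof (rule tendsto_upperbound[OF lim])
    have "\<forall>\<^sub>F n in sequentially. AE x in M. \<bar>s n x - X x\<bar> \<le> e"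
      using s(2) \<open>e > 0\<close> by (simp add: Linf_tendsto_def)
    then show "\<forall>\<^sub>F n in sequentially. fa_simple_integral M p (s n) \<le> (c + e) * p (space M)"
    proof eventually_elim
      case (elim n)
      have "AE x in M. x \<notin> N \<longrightarrow> s n x \<le> c + e"
        using elim le by eventually_elim auto
      then obtain N' where N': "{x \<in> space M. \<not> (x \<notin> N \<longrightarrow> s n x \<le> c + e)} \<subseteq> N'"
          "emeasure M N' = 0" "N' \<in> sets M"
        by (rule AE_E)
      have "p N' = 0" using pb N' by (auto simp: ba_def)
      let ?D = "\<lambda>y. s n -` {y} \<inter> space M"
      have D: "?D y \<in> sets M" for y by (rule simple_functionD(2)[OF s(1)])
      have "fa_simple_integral M p (s n) \<le> (\<Sum>y\<in>s n ` space M. (c + e) * p (?D y))"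
        unfolding fa_simple_integral_def
      proof (rule sum_mono)
        fix y
        show "y * p (?D y) \<le> (c + e) * p (?D y)"
        proof (cases "y \<le> c + e")
          case True
          then show ?thesis using p D by (intro mult_right_mono) (auto simp: ba_pos_def)
        next
          case False
          have "p (?D y) = 0"
            by (rule ba_pos_eq_0_of_subset_Un[OF p D _ N(1) N'(3) N(2) \<open>p N' = 0\<close>])
              (use False N'(1) in auto)
          then show ?thesis by simp
        qed
      qed
      also have "\<dots> = (c + e) * p (\<Union>y\<in>s n ` space M. ?D y)"
        unfolding sum_distrib_left[symmetric]
        by (subst ba_UN[OF pb])
          (use D in \<open>auto simp: disjoint_family_on_def intro: simple_functionD(1)[OF s(1)]\<close>)
      also have "(\<Union>y\<in>s n ` space M. ?D y) = space M" by auto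
      finally show ?case .
    qed
  qed simp
  have "(\<lambda>k. (c + 1 / real (Suc k)) * p (space M)) \<longlonglongrightarrow> (c + 0) * p (space M)"
    using LIMSEQ_inverse_real_of_nat
    by (intro tendsto_intros) (simp add: inverse_eq_divide)
  then show ?thesis
    by (rule LIMSEQ_le_const[THEN order_trans]) (auto intro!: bound)
qed

lemma fa_expectation_ge:
  assumes p: "p \<in> ba_pos M" and X: "X \<in> Linf M"
    and N: "N \<in> sets M" "p N = 0"
    and ge: "AE x in M. x \<notin> N \<longrightarrow> c \<le> X x"
  shows "c * p (space M) \<le> fa_expectation M p X"
  using fa_expectation_le[OF p Linf_uminus[OF X] N, of "- c"] ge p X
  by (simp add: fa_expectation_uminus ba_pos_def)

lemma fa_expectation_const:
  assumes p: "p \<in> ba_pos M"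
  shows "fa_expectation M p (\<lambda>_. c) = c * p (space M)"
proof -
  have "p {} = 0" using p by (auto simp: ba_pos_def intro: ba_empty)
  then show ?thesis
    using fa_expectation_le[OF p Linf_const, of "{}" c c]
      fa_expectation_ge[OF p Linf_const, of "{}" c c] by simp
qed

lemma fa_probs_iff: "p \<in> fa_probs M \<longleftrightarrow> p \<in> ba_pos M \<and> p (space M) = 1"
  by (auto simp: fa_probs_def fa_expectation_const)

section \<open>Existence of concentrated finitely additive probabilities\<close>

lemma sum_disjoint_eq_Union_of_additive:
  fixes p :: "'a set \<Rightarrow> real"
  assumes add: "\<And>A B. A \<in> sets M \<Longrightarrow> B \<in> sets M \<Longrightarrow> A \<inter> B = {} \<Longrightarrow> p (A \<union> B) = p A + p B"
    and "finite \<A>" "disjoint \<A>" "\<A> \<subseteq> sets M"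
  shows "(\<Sum>A\<in>\<A>. p A) = p (\<Union>\<A>)"
  using assms(2-)
proof (induction \<A>)
  case empty
  then show ?case using add[of "{}" "{}"] by simp
next
  case (insert A \<A>)
  have "A \<inter> \<Union>\<A> = {}"
    using insert.hyps insert.prems(1) by (fastforce simp: disjoint_def)
  moreover have "disjoint \<A>" using insert.prems(1) by (auto simp: disjoint_def)
  moreover have "\<Union>\<A> \<in> sets M" using insert by auto
  ultimately show ?case using insert add[of A "\<Union>\<A>"] by simp
qed

text \<open>By positivity and additivity, the total variation is at most \<open>p (space M) = 1\<close>.\<close>

lemma fa_probsI:
  assumes add: "\<And>A B. A \<in> sets M \<Longrightarrow> B \<in> sets M \<Longrightarrow> A \<inter> B = {} \<Longrightarrow> p (A \<union> B) = p A + p B"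
    and nonneg: "\<And>A. A \<in> sets M \<Longrightarrow> 0 \<le> p A"
    and null: "\<And>A. A \<in> sets M \<Longrightarrow> emeasure M A = 0 \<Longrightarrow> p A = 0"
    and one: "p (space M) = 1"
  shows "p \<in> fa_probs M"
proof -
  have "(\<Sum>A\<in>\<A>. \<bar>p A\<bar>) \<le> 1" if \<A>: "finite \<A>" "disjoint \<A>" "\<A> \<subseteq> sets M" for \<A>
  proof -
    have U: "\<Union>\<A> \<in> sets M" using \<A> by auto
    have "(\<Sum>A\<in>\<A>. \<bar>p A\<bar>) = (\<Sum>A\<in>\<A>. p A)"
      using nonneg \<A> by (intro sum.cong) auto
    also have "\<dots> = p (\<Union>\<A>)" by (rule sum_disjoint_eq_Union_of_additive[OF add \<A>])
    also have "\<dots> \<le> p (\<Union>\<A>) + p (space M - \<Union>\<A>)" using nonneg U by simp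
    also have "\<dots> = p (\<Union>\<A> \<union> (space M - \<Union>\<A>))" using U by (intro add[symmetric]) auto
    also have "\<Union>\<A> \<union> (space M - \<Union>\<A>) = space M" using sets.sets_into_space[OF U] by blast
    finally show ?thesis using one by simp
  qed
  then show ?thesis
    unfolding fa_probs_iff ba_pos_def ba_def using add nonneg null one by blast
qed

lemma compact_PiE_UNIV:
  fixes K :: "'i \<Rightarrow> 'b::topological_space set"
  assumes "\<And>i. compact (K i)"
  shows "compact (PiE UNIV K)"
proof -
  have "compactin (product_topology (\<lambda>_. euclidean) UNIV) (PiE UNIV K)"
    using assms by (simp add: compactin_PiE)
  then show ?thesis by (simp add: euclidean_product_topology)
qed

text \<open>
  For finitely many of the sets \<open>B i\<close>, conditioning on their intersection gives a probability
  that is concentrated on each of them. Compactness passes from finite subfamilies to the whole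
  family, at the price of countable additivity: additivity on two sets is a closed condition for
  the topology of setwise convergence, additivity on infinitely many sets is not.
\<close>

lemma fa_probs_concentrated:
  assumes "prob_space M"
    and B: "\<And>i. i \<in> I \<Longrightarrow> B i \<in> sets M"
    and pos: "\<And>J. finite J \<Longrightarrow> J \<subseteq> I \<Longrightarrow> measure M (space M \<inter> (\<Inter>i\<in>J. B i)) > 0"
  obtains p where "p \<in> fa_probs M" "\<And>i. i \<in> I \<Longrightarrow> p (space M - B i) = 0"
proof -
  interpret prob_space M by fact
  define K where "K = (PiE UNIV (\<lambda>_. {0..1}) :: ('a set \<Rightarrow> real) set)"
  define Add where "Add = (\<lambda>(A, B). {p :: 'a set \<Rightarrow> real. p (A \<union> B) = p A + p B})"
  define Val where "Val = (\<lambda>A c. {p :: 'a set \<Rightarrow> real. p A = c})"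
  define P where "P = K
    \<inter> (\<Inter>AB\<in>{(A, B). A \<in> sets M \<and> B \<in> sets M \<and> A \<inter> B = {}}. Add AB)
    \<inter> (\<Inter>A\<in>null_sets M. Val A 0) \<inter> Val (space M) 1"
  have closed_Add: "closed (Add AB)" for AB
    unfolding Add_def by (cases AB) (simp, intro closed_Collect_eq continuous_intros
        continuous_on_product_coordinates)
  have closed_Val: "closed (Val A c)" for A c
    unfolding Val_def by (intro closed_Collect_eq continuous_intros
        continuous_on_product_coordinates)
  have "compact K" unfolding K_def by (rule compact_PiE_UNIV) simp
  then have "compact P"
    unfolding P_def
    by (intro compact_Int_closed closed_INT ballI closed_Add closed_Val)
  then have "P \<inter> (\<Inter>i\<in>I. Val (space M - B i) 0) \<noteq> {}"
  proof (rule compact_imp_fip_image)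
    show "closed (Val (space M - B i) 0)" for i by (rule closed_Val)
  next
    fix J assume J: "finite J" "J \<subseteq> I"
    define C where "C = space M \<inter> (\<Inter>i\<in>J. B i)"
    define p where "p = (\<lambda>A. measure M (A \<inter> C) / measure M C)"
    have C: "C \<in> sets M" unfolding C_def using J B
      by (cases "J = {}") (auto intro!: sets.Int sets.finite_INT)
    have C_pos: "measure M C > 0" unfolding C_def by (rule pos[OF J])
    have "p \<in> K"
      using C C_pos by (auto simp: K_def p_def PiE_iff intro!: finite_measure_mono)
    moreover have "p (A \<union> B) = p A + p B"
      if "A \<in> sets M" "B \<in> sets M" "A \<inter> B = {}" for A B
    proof -
      have "measure M ((A \<inter> C) \<union> (B \<inter> C)) = measure M (A \<inter> C) + measure M (B \<inter> C)"
        using that C by (intro finite_measure_Union) auto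
      then show ?thesis by (simp add: p_def Int_Un_distrib2 add_divide_distrib)
    qed
    moreover have "p A = 0" if "A \<in> null_sets M" for A
    proof -
      have "A \<inter> C \<in> null_sets M" using that C by (rule null_set_Int2)
      then show ?thesis by (simp add: p_def measure_eq_0_null_sets)
    qed
    moreover have "p (space M) = 1"
    proof -
      have "space M \<inter> C = C" by (auto simp: C_def)
      then show ?thesis using C_pos by (simp add: p_def)
    qed
    moreover have "p (space M - B i) = 0" if "i \<in> J" for i
    proof -
      have "(space M - B i) \<inter> C = {}" using that by (auto simp: C_def)
      then show ?thesis by (simp add: p_def)
    qed
    ultimately have "p \<in> P \<inter> (\<Inter>i\<in>J. Val (space M - B i) 0)"
      by (auto simp: P_def Add_def Val_def)
    then show "P \<inter> (\<Inter>i\<in>J. Val (space M - B i) 0) \<noteq> {}" by blast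
  qed
  then obtain p where p: "p \<in> P" "\<And>i. i \<in> I \<Longrightarrow> p (space M - B i) = 0"
    by (auto simp: Val_def)
  have "p \<in> fa_probs M"
    by (rule fa_probsI) (use p(1) in \<open>auto simp: P_def K_def Add_def Val_def PiE_iff null_sets_def\<close>)
  then show ?thesis using p(2) by (rule that)
qed

section \<open>The maximal expectation is the essential supremum\<close>

text \<open>
  The infimum of the almost sure upper bounds is itself one, being the limit of a sequence of
  them: countably many null sets have a null union.
\<close>

lemma Linf_essential_supremum:
  assumes "prob_space M" and X: "X \<in> Linf M"
  obtains a where "AE x in M. X x \<le> a" "\<And>c. c < a \<Longrightarrow> \<not> (AE x in M. X x \<le> c)"
proof -
  interpret prob_space M by fact
  define S where "S = {c. AE x in M. X x \<le> c}"
  obtain C where C: "AE x in M. \<bar>X x\<bar> \<le> C" using X by (auto simp: Linf_def)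
  have "AE x in M. X x \<le> C" using C by eventually_elim auto
  then have ne: "S \<noteq> {}" by (auto simp: S_def)
  have bdd: "bdd_below S"
  proof (rule bdd_belowI)
    fix c assume "c \<in> S"
    then have "AE x in M. X x \<le> c" by (simp add: S_def)
    with C have "AE x in M. - C \<le> c" by eventually_elim auto
    then show "- C \<le> c" by simp
  qed
  have "AE x in M. X x \<le> Inf S + 1 / real (Suc n)" for n
  proof -
    obtain c where "c \<in> S" "c < Inf S + 1 / real (Suc n)"
      using cInf_lessD[OF ne, of "Inf S + 1 / real (Suc n)"] by auto
    then show ?thesis unfolding S_def mem_Collect_eq by (auto elim!: eventually_mono)
  qed
  then have "AE x in M. \<forall>n. X x \<le> Inf S + 1 / real (Suc n)"
    by (simp add: AE_all_countable)
  then have "AE x in M. X x \<le> Inf S"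
  proof eventually_elim
    case (elim x)
    have "(\<lambda>n. Inf S + 1 / real (Suc n)) \<longlonglongrightarrow> Inf S + 0"
      using LIMSEQ_inverse_real_of_nat
      by (intro tendsto_intros) (simp add: inverse_eq_divide)
    then show ?case using elim by (intro LIMSEQ_le_const[of _ "Inf S" "X x"]) auto
  qed
  moreover have "\<not> (AE x in M. X x \<le> c)" if "c < Inf S" for c
    using that cInf_lower[OF _ bdd, of c] by (auto simp: S_def)
  ultimately show ?thesis by (rule that)
qed

lemma is_maximum_fa_expectation_essential_supremum:
  assumes "prob_space M" and X: "X \<in> Linf M"
    and upper: "AE x in M. X x \<le> a" and least: "\<And>c. c < a \<Longrightarrow> \<not> (AE x in M. X x \<le> c)"
  shows "is_maximum ((\<lambda>p. fa_expectation M p X) ` fa_probs M) a"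
proof -
  interpret prob_space M by fact
  have X_meas: "X \<in> borel_measurable M" using X by (simp add: Linf_def)
  have le: "fa_expectation M p X \<le> a" if "p \<in> fa_probs M" for p
  proof -
    have p: "p \<in> ba_pos M" "p (space M) = 1" using that by (auto simp: fa_probs_iff)
    have "p {} = 0" using p(1) by (auto simp: ba_pos_def intro: ba_empty)
    then show ?thesis using fa_expectation_le[OF p(1) X, of "{}" a] upper p(2) by simp
  qed
  define B where "B = (\<lambda>c. {x \<in> space M. c < X x})"
  have B: "B c \<in> sets M" for c unfolding B_def using X_meas by measurable
  have "measure M (space M \<inter> (\<Inter>c\<in>J. B c)) > 0" if J: "finite J" "J \<subseteq> {..<a}" for J
  proof -
    \<comment> \<open>\<open>a - 1\<close> is added for the case of an empty \<open>J\<close>\<close>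
    define m where "m = Max (insert (a - 1) J)"
    have "m < a" using J by (auto simp: m_def)
    then have "\<not> (AE x in M. x \<notin> B m)"
      using least by (auto simp: B_def not_less cong: AE_cong_simp)
    then have "B m \<notin> null_sets M" using AE_iff_null_sets[OF B, of m] by simp
    then have "measure M (B m) > 0"
      using B by (auto simp: null_sets_def emeasure_eq_measure zero_less_measure_iff)
    also have "measure M (B m) \<le> measure M (space M \<inter> (\<Inter>c\<in>J. B c))"
    proof (rule finite_measure_mono)
      have "c \<le> m" if "c \<in> J" for c using J that by (simp add: m_def)
      then show "B m \<subseteq> space M \<inter> (\<Inter>c\<in>J. B c)" by (force simp: B_def)
      show "space M \<inter> (\<Inter>c\<in>J. B c) \<in> sets M" using J B by (cases "J = {}") auto
    qed
    finally show ?thesis .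
  qed
  then obtain p where p: "p \<in> fa_probs M" "\<And>c. c \<in> {..<a} \<Longrightarrow> p (space M - B c) = 0"
    using fa_probs_concentrated[OF \<open>prob_space M\<close>, of "{..<a}" B] B by blast
  have "a \<le> fa_expectation M p X"
  proof (rule dense_le)
    fix c assume "c < a"
    have "c * p (space M) \<le> fa_expectation M p X"
    proof (rule fa_expectation_ge[OF _ X])
      show "p \<in> ba_pos M" using p(1) by (simp add: fa_probs_iff)
      show "space M - B c \<in> sets M" using B by blast
      show "p (space M - B c) = 0" using \<open>c < a\<close> by (intro p(2)) simp
      show "AE x in M. x \<notin> space M - B c \<longrightarrow> c \<le> X x" by (rule AE_I2) (auto simp: B_def)
    qed
    then show "c \<le> fa_expectation M p X" using p(1) by (simp add: fa_probs_iff)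
  qed
  with le[OF p(1)] have "a = fa_expectation M p X" by simp
  then have "a \<in> (\<lambda>p. fa_expectation M p X) ` fa_probs M" using p(1) by (rule image_eqI)
  with le show ?thesis by (auto simp: is_maximum_def)
qed

lemma is_maximum_imp_Sup_eq: "is_maximum S m \<Longrightarrow> Sup S = m"
  by (auto simp: is_maximum_def intro: cSup_eq_maximum)

section \<open>The representation of risk measures\<close>

theorem corollary4p1:
  fixes M :: "'a measure" and \<mu> :: "('a \<Rightarrow> real) \<Rightarrow> real"
  assumes "prob_space M" and "risk_measure M \<mu>"
  shows "\<forall>X\<in>Linf M.
    (\<forall>Y\<in>Linf M. \<mu> Y = 0 \<longrightarrow>
       is_maximum ((\<lambda>p. fa_expectation M p (\<lambda>x. Y x - X x)) ` fa_probs M)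
         (SUP p\<in>fa_probs M. fa_expectation M p (\<lambda>x. Y x - X x))) \<and>
    is_minimum ((\<lambda>Y. SUP p\<in>fa_probs M. fa_expectation M p (\<lambda>x. Y x - X x)) ` {Y \<in> Linf M. \<mu> Y = 0})
      (\<mu> X)"
proof
  fix X assume X: "X \<in> Linf M"
  interpret prob_space M by fact
  let ?E = "\<lambda>Y p. fa_expectation M p (\<lambda>x. Y x - X x)"
  have antimono: "\<mu> V \<le> \<mu> U"
    if "U \<in> Linf M" "V \<in> Linf M" "AE x in M. U x \<le> V x" for U V
    using assms(2) that by (simp add: risk_measure_def)
  have cash: "\<mu> (\<lambda>x. X x + c) = \<mu> X - c" for c
    using assms(2) X by (simp add: risk_measure_def)
  have max_lower: "is_maximum (?E Y ` fa_probs M) (Sup (?E Y ` fa_probs M))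
      \<and> \<mu> X \<le> Sup (?E Y ` fa_probs M)" if Y: "Y \<in> Linf M" "\<mu> Y = 0" for Y
  proof -
    have D: "(\<lambda>x. Y x - X x) \<in> Linf M" by (rule Linf_diff[OF Y(1) X])
    obtain a where a: "AE x in M. Y x - X x \<le> a"
        "\<And>c. c < a \<Longrightarrow> \<not> (AE x in M. Y x - X x \<le> c)"
      using Linf_essential_supremum[OF assms(1) D] by blast
    have max: "is_maximum (?E Y ` fa_probs M) a"
      by (rule is_maximum_fa_expectation_essential_supremum[OF assms(1) D a])
    have "AE x in M. Y x \<le> X x + a" using a(1) by eventually_elim linarith
    then have "\<mu> (\<lambda>x. X x + a) \<le> \<mu> Y"
      by (rule antimono[OF Y(1) Linf_add_const[OF X]])
    then show ?thesis using max Y(2) cash by (simp add: is_maximum_imp_Sup_eq)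
  qed
  let ?Y = "\<lambda>x. X x + \<mu> X"
  have "is_maximum (?E ?Y ` fa_probs M) (\<mu> X)"
    using is_maximum_fa_expectation_essential_supremum[OF assms(1) Linf_const, of "\<mu> X" "\<mu> X"]
    by simp
  then have "Sup (?E ?Y ` fa_probs M) = \<mu> X" by (rule is_maximum_imp_Sup_eq)
  moreover have "?Y \<in> {Y \<in> Linf M. \<mu> Y = 0}" using Linf_add_const[OF X] cash by simp
  ultimately have "\<mu> X \<in> (\<lambda>Y. Sup (?E Y ` fa_probs M)) ` {Y \<in> Linf M. \<mu> Y = 0}"
    by (intro image_eqI[where x = ?Y]) simp_all
  with max_lower show "(\<forall>Y\<in>Linf M. \<mu> Y = 0 \<longrightarrow>
       is_maximum (?E Y ` fa_probs M) (Sup (?E Y ` fa_probs M))) \<and>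
    is_minimum ((\<lambda>Y. Sup (?E Y ` fa_probs M)) ` {Y \<in> Linf M. \<mu> Y = 0}) (\<mu> X)"
    by (auto simp: is_minimum_def)
qed

end
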